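(* For a set of patterns $\{\rho_1,\rho_2\}$, let $\mathrm{a}_{n,k}^{\mathrm{pk}}(\rho_1,\rho_2)$ (respectively $\mathrm{a}_{n,k}^{\mathrm{vl}}(\rho_1,\rho_2)$) denote the number of permutations of $\{1,\dots,n\}$ that avoid both $\rho_1$ and $\rho_2$ and have exactly $k$ peaks (respectively $k$ valleys). Then for all integers $n\ge1$ and $k\ge0$, $$\mathrm{a}_{n,k}^{\mathrm{pk}}(132,213)=\mathrm{a}_{n,k}^{\mathrm{vl}}(132,213)=\mathrm{a}_{n,k}^{\mathrm{pk}}(213,231)=\mathrm{a}_{n,k}^{\mathrm{vl}}(213,231)=\binom{n}{2k+1}.$$
   Context: $\mathcal{S}_n$ is the set of permutations $\pi=\pi_1\cdots\pi_n$ of $\{1,\dots,n\}$. For $\rho\in\mathcal{S}_m$, $\pi\in\mathcal{S}_n$ contains $\rho$ if there are indices $1\le i_1<\cdots<i_m\le n$ such that $\pi_{i_a}<\pi_{i_b}$ if and only if $\rho_a<\rho_b$; otherwise $\pi$ avoids $\rho$. The number of peaks is $\mathrm{pk}(\pi)=|\{i:\pi_i<\pi_{i+1}\text{ and }\pi_{i+1}>\pi_{i+2}\}|$ and the number of valleys is $\mathrm{vl}(\pi)=|\{i:\pi_i>\pi_{i+1}\text{ and }\pi_{i+1}<\pi_{i+2}\}|$, where $1\le i\le n-2$. Binomial coefficients $\binom{m}{j}$ with $j>m\ge 0$ are $0$. *)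

theory Defs
  imports "HOL-Combinatorics.Multiset_Permutations"
begin

text \<open>
  A permutation of \<open>{1..n}\<close> is written in one-line notation as a list, i.e. as an element of
  \<^term>\<open>permutations_of_set {1..n}\<close>. List positions are counted from 0, so the entry
  written \<open>\<pi>\<^sub>i\<close> is \<^term>\<open>\<pi> ! (i - 1)\<close>.
\<close>

definition contains_pattern :: "nat list \<Rightarrow> nat list \<Rightarrow> bool" where
  "contains_pattern \<pi> \<rho> \<longleftrightarrow>
     (\<exists>f :: nat \<Rightarrow> nat. strict_mono_on {..<length \<rho>} f \<and> f ` {..<length \<rho>} \<subseteq> {..<length \<pi>} \<and>
        (\<forall>a<length \<rho>. \<forall>b<length \<rho>. \<pi> ! f a < \<pi> ! f b \<longleftrightarrow> \<rho> ! a < \<rho> ! b))"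

definition avoids :: "nat list \<Rightarrow> nat list \<Rightarrow> bool" where
  "avoids \<pi> \<rho> \<longleftrightarrow> \<not> contains_pattern \<pi> \<rho>"

definition pk :: "nat list \<Rightarrow> nat" where
  "pk \<pi> = card {i. i + 2 < length \<pi> \<and> \<pi> ! i < \<pi> ! (i + 1) \<and> \<pi> ! (i + 1) > \<pi> ! (i + 2)}"

definition vl :: "nat list \<Rightarrow> nat" where
  "vl \<pi> = card {i. i + 2 < length \<pi> \<and> \<pi> ! i > \<pi> ! (i + 1) \<and> \<pi> ! (i + 1) < \<pi> ! (i + 2)}"

definition a_pk :: "nat \<Rightarrow> nat \<Rightarrow> nat list \<Rightarrow> nat list \<Rightarrow> nat" where
  "a_pk n k \<rho>1 \<rho>2 =
     card {\<pi> \<in> permutations_of_set {1..n}. avoids \<pi> \<rho>1 \<and> avoids \<pi> \<rho>2 \<and> pk \<pi> = k}"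

definition a_vl :: "nat \<Rightarrow> nat \<Rightarrow> nat list \<Rightarrow> nat list \<Rightarrow> nat" where
  "a_vl n k \<rho>1 \<rho>2 =
     card {\<pi> \<in> permutations_of_set {1..n}. avoids \<pi> \<rho>1 \<and> avoids \<pi> \<rho>2 \<and> vl \<pi> = k}"

end

theory Submission
  imports Defs
begin

text \<open>
  In both classes a permutation is determined by its ascent set. If \<open>\<pi>\<close> avoids 213 and 231, every
  entry is the minimum or the maximum of the entries from its position on, so for \<open>i < j\<close> we have
  \<open>\<pi>\<^sub>i < \<pi>\<^sub>j\<close> iff \<open>i\<close> is an ascent. If \<open>\<pi>\<close> avoids 132 and 213, then \<open>\<pi>\<^sub>i < \<pi>\<^sub>j\<close> iff all of
  \<open>i, \<dots>, j - 1\<close> are ascents. Conversely, for every set of positions these rules define a linear order,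
  hence a permutation. So each class is in bijection with the subsets of the \<open>n - 1\<close> possible ascents;
  peaks become places where an ascent is followed by a descent, and the subsets with \<open>k\<close> such places
  are counted by a Pascal-type recursion. Complementing the subset exchanges peaks and valleys.
\<close>

section \<open>Permutations and linear orders on positions\<close>

text \<open>The entries smaller than \<open>p ! i\<close> are exactly
  \<open>1, ..., p ! i - 1\<close>, each occurring once. Hence the comparisons between positions
  already determine every entry.\<close>

lemma permutation_nth_eq_card:
  assumes p: "p \<in> permutations_of_set {1..n}" and i: "i < n"
  shows "p ! i = Suc (card {j. j < n \<and> p ! j < p ! i})"
proof -
  have len: "length p = n" and d: "distinct p" and s: "set p = {1..n}"
    using p by (auto simp: permutations_of_set_def dest: distinct_card)
  have mem: "p ! i \<in> {1..n}" using s len i nth_mem by metis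
  have "bij_betw ((!) p) {j. j < n \<and> p ! j < p ! i} {1..<p ! i}"
    unfolding bij_betw_def
  proof
    show "inj_on ((!) p) {j. j < n \<and> p ! j < p ! i}"
      using d len by (auto simp: inj_on_def nth_eq_iff_index_eq)
    show "(!) p ` {j. j < n \<and> p ! j < p ! i} = {1..<p ! i}"
    proof (intro equalityI subsetI)
      fix x assume "x \<in> (!) p ` {j. j < n \<and> p ! j < p ! i}"
      then show "x \<in> {1..<p ! i}" using s len nth_mem by fastforce
    next
      fix x assume x: "x \<in> {1..<p ! i}"
      then have "x \<in> set p" using s mem by auto
      then show "x \<in> (!) p ` {j. j < n \<and> p ! j < p ! i}"
        using x len by (auto simp: in_set_conv_nth)
    qed
  qed
  from bij_betw_same_card[OF this] show ?thesis using mem by auto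
qed

lemma permutation_eqI:
  assumes p: "p \<in> permutations_of_set {1..n}" and q: "q \<in> permutations_of_set {1..n}"
    and "\<And>i j. i < n \<Longrightarrow> j < n \<Longrightarrow> p ! i < p ! j \<longleftrightarrow> q ! i < q ! j"
  shows "p = q"
proof (rule nth_equalityI)
  have len: "length p = n" "length q = n"
    using p q by (auto simp: permutations_of_set_def dest: distinct_card)
  then show "length p = length q" by simp
  fix i assume "i < length p"
  then have i: "i < n" using len by simp
  have "{j. j < n \<and> p ! j < p ! i} = {j. j < n \<and> q ! j < q ! i}"
    using assms(3) i by auto
  then show "p ! i = q ! i"
    using permutation_nth_eq_card[OF p i] permutation_nth_eq_card[OF q i] by simp
qed

text \<open>The entry at a position is its rank under \<open>R\<close> among the first
  \<open>n\<close> positions.\<close>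

lemma permutation_of_linear_order:
  fixes R :: "nat \<Rightarrow> nat \<Rightarrow> bool"
  assumes irr: "\<And>i. \<not> R i i"
    and tr: "\<And>i j l. R i j \<Longrightarrow> R j l \<Longrightarrow> R i l"
    and tot: "\<And>i j. i \<noteq> j \<Longrightarrow> R i j \<or> R j i"
  obtains p where "p \<in> permutations_of_set {1..n}"
    and "\<And>i j. i < n \<Longrightarrow> j < n \<Longrightarrow> p ! i < p ! j \<longleftrightarrow> R i j"
proof -
  define r where "r i = Suc (card {j. j < n \<and> R j i})" for i
  define p where "p = map r [0..<n]"
  \<comment> \<open>Transitivity gives the inclusion; \<open>i\<close> itself, which must lie below
    \<open>n\<close>, makes it strict.\<close>
  have less: "r i < r j" if "R i j" "i < n" for i j
  proof -
    have "{l. l < n \<and> R l i} \<subset> {l. l < n \<and> R l j}"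
      using that irr tr by blast
    then show ?thesis by (simp add: r_def psubset_card_mono)
  qed
  have iff: "r i < r j \<longleftrightarrow> R i j" if "i < n" "j < n" for i j
    using less tot that by (metis less_asym less_irrefl)
  have inj: "inj_on r {..<n}"
    using less tot by (metis inj_onI lessThan_iff less_irrefl)
  have "r ` {..<n} \<subseteq> {1..n}"
  proof clarsimp
    fix i assume "i < n"
    then have "{j. j < n \<and> R j i} \<subset> {..<n}" using irr by auto
    then have "card {j. j < n \<and> R j i} < n"
      by (metis card_lessThan finite_lessThan psubset_card_mono)
    then show "Suc 0 \<le> r i \<and> r i \<le> n" by (simp add: r_def)
  qed
  then have "r ` {..<n} = {1..n}"
    using inj by (intro card_subset_eq) (auto simp: card_image)
  then have "p \<in> permutations_of_set {1..n}"
    using inj by (auto simp: p_def permutations_of_set_def distinct_map atLeast0LessThan)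
  moreover have "p ! i < p ! j \<longleftrightarrow> R i j" if "i < n" "j < n" for i j
    using that iff by (simp add: p_def)
  ultimately show thesis by (rule that)
qed

section \<open>Ascent sets\<close>

definition ascents :: "nat list \<Rightarrow> nat set" where
  "ascents p = {i. Suc i < length p \<and> p ! i < p ! Suc i}"

text \<open>Common frame for both classes: \<open>R W\<close> is the order of positions encoded by
  \<open>W\<close>, and \<open>C\<close> says that \<open>p\<close> is ordered by its own ascent
  set. Injectivity holds because comparisons determine \<open>p\<close>; for surjectivity,
  \<open>asc\<close> ensures that a permutation realizing \<open>R W\<close> has ascent set
  \<open>W\<close>.\<close>

lemma bij_betw_ascents:
  fixes R :: "nat set \<Rightarrow> nat \<Rightarrow> nat \<Rightarrow> bool"
  assumes irr: "\<And>W i. \<not> R W i i"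
    and tr: "\<And>W i j l. R W i j \<Longrightarrow> R W j l \<Longrightarrow> R W i l"
    and tot: "\<And>W i j. i \<noteq> j \<Longrightarrow> R W i j \<or> R W j i"
    and asc: "\<And>W i. R W i (Suc i) \<longleftrightarrow> i \<in> W"
    and C: "\<And>p. distinct p \<Longrightarrow>
      C p \<longleftrightarrow> (\<forall>j < length p. \<forall>i < j. p ! i < p ! j \<longleftrightarrow> R (ascents p) i j)"
  shows "bij_betw ascents {p \<in> permutations_of_set {1..n}. C p} (Pow {..<n - 1})"
  unfolding bij_betw_def
proof
  have perm: "length p = n" "distinct p" if "p \<in> permutations_of_set {1..n}" for p
    using that by (auto simp: permutations_of_set_def dest: distinct_card)
  have anti: "R W j i \<longleftrightarrow> \<not> R W i j" if "i \<noteq> j" for W i j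
    using irr tr tot that by blast
  \<comment> \<open>Distinct entries and totality extend the criterion from \<open>i < j\<close> to
    all pairs.\<close>
  have C': "C p \<longleftrightarrow> (\<forall>i < n. \<forall>j < n. p ! i < p ! j \<longleftrightarrow> R (ascents p) i j)"
    if p: "p \<in> permutations_of_set {1..n}" for p
  proof
    assume "C p"
    then have *: "p ! i < p ! j \<longleftrightarrow> R (ascents p) i j" if "i < j" "j < n" for i j
      using C perm[OF p] that by simp
    show "\<forall>i < n. \<forall>j < n. p ! i < p ! j \<longleftrightarrow> R (ascents p) i j"
    proof (intro allI impI)
      fix i j assume ij: "i < n" "j < n"
      consider "i < j" | "i = j" | "j < i" by linarith
      then show "p ! i < p ! j \<longleftrightarrow> R (ascents p) i j"
      proof cases
        case 3
        then have "p ! i \<noteq> p ! j" using perm[OF p] ij by (simp add: nth_eq_iff_index_eq)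
        then show ?thesis using *[OF 3 ij(1)] anti 3 by (metis less_asym nat_neq_iff)
      qed (use * irr ij in auto)
    qed
  qed (use C perm[OF p] in auto)
  show "inj_on ascents {p \<in> permutations_of_set {1..n}. C p}"
    by (rule inj_onI) (auto simp: C' intro: permutation_eqI)
  show "ascents ` {p \<in> permutations_of_set {1..n}. C p} = Pow {..<n - 1}"
  proof (intro equalityI subsetI)
    fix W assume "W \<in> ascents ` {p \<in> permutations_of_set {1..n}. C p}"
    then show "W \<in> Pow {..<n - 1}" using perm by (auto simp: ascents_def)
  next
    fix W assume W: "W \<in> Pow {..<n - 1}"
    obtain p where p: "p \<in> permutations_of_set {1..n}"
      and R: "\<And>i j. i < n \<Longrightarrow> j < n \<Longrightarrow> p ! i < p ! j \<longleftrightarrow> R W i j"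
      using permutation_of_linear_order[of "R W" n] irr tr tot by metis
    have "ascents p = W"
      using W R asc perm[OF p] by (auto simp: ascents_def)
    then show "W \<in> ascents ` {p \<in> permutations_of_set {1..n}. C p}"
      using p R C'[OF p] by auto
  qed
qed

text \<open>If \<open>W\<close> is the ascent set of a permutation with \<open>N\<close> adjacent
  pairs, these are its ascents followed by a descent, that is, its peaks.\<close>

definition turns :: "nat \<Rightarrow> nat set \<Rightarrow> nat set" where
  "turns N W = {i \<in> W. Suc i < N \<and> Suc i \<notin> W}"

lemma pk_eq_card_turns:
  assumes "distinct p"
  shows "pk p = card (turns (length p - 1) (ascents p))"
proof -
  have "p ! (i + 1) > p ! (i + 2) \<longleftrightarrow> \<not> p ! Suc i < p ! Suc (Suc i)" if "i + 2 < length p" for i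
    using that assms by (auto simp: not_less le_less nth_eq_iff_index_eq)
  then show ?thesis
    unfolding pk_def turns_def ascents_def by (intro arg_cong[where f = card]) auto
qed

text \<open>With distinct entries the complement of the ascent set is the descent set, and a valley
  is a descent followed by an ascent.\<close>

lemma vl_eq_card_turns:
  assumes "distinct p"
  shows "vl p = card (turns (length p - 1) ({..<length p - 1} - ascents p))"
proof -
  have "p ! i > p ! (i + 1) \<longleftrightarrow> \<not> p ! i < p ! Suc i" if "i + 2 < length p" for i
    using that assms by (auto simp: not_less le_less nth_eq_iff_index_eq)
  then show ?thesis
    unfolding vl_def turns_def ascents_def by (intro arg_cong[where f = card]) auto
qed

section \<open>Counting subsets by turns\<close>

text \<open>Case split on whether \<open>N\<close> belongs to the subset.\<close>

lemma card_Pow_lessThan_Suc: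
  "card {W \<in> Pow {..<Suc N}. P W} =
     card {W \<in> Pow {..<N}. P W} + card {W \<in> Pow {..<N}. P (insert N W)}"
proof -
  have eq: "{W \<in> Pow {..<Suc N}. P W} =
      {W \<in> Pow {..<N}. P W} \<union> insert N ` {W \<in> Pow {..<N}. P (insert N W)}"
    unfolding lessThan_Suc Pow_insert by auto
  have "inj_on (insert N) {W \<in> Pow {..<N}. P (insert N W)}"
    by (rule inj_onI) (metis (no_types, lifting) Diff_insert_absorb PowD lessThan_iff
        less_irrefl mem_Collect_eq subsetD insert_ident)
  then have "card (insert N ` {W \<in> Pow {..<N}. P (insert N W)}) =
      card {W \<in> Pow {..<N}. P (insert N W)}"
    by (rule card_image)
  moreover have "{W \<in> Pow {..<N}. P W} \<inter> insert N ` {W \<in> Pow {..<N}. P (insert N W)} = {}"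
    by auto
  ultimately show ?thesis
    unfolding eq by (subst card_Un_disjoint) auto
qed

text \<open>The bound \<open>Suc N\<close> in the second count also makes the last element of \<open>W\<close> a turn if it is
  \<open>N - 1\<close>, which closes the recursion.\<close>

lemma card_turns_eq:
  "card {W \<in> Pow {..<N}. card (turns N W) = k} = Suc N choose (2 * k + 1) \<and>
   card {W \<in> Pow {..<N}. card (turns (Suc N) W) = k} = Suc N choose (2 * k)"
proof (induction N arbitrary: k)
  case 0
  have "{W :: nat set. W = {} \<and> P W} = (if P {} then {{}} else {})" for P by auto
  then show ?case by (cases k) (auto simp: turns_def)
next
  case (Suc N)
  \<comment> \<open>Adding \<open>N\<close> prevents \<open>N - 1\<close> from being a turn;
    \<open>N\<close> itself becomes one only under the larger bound.\<close>
  have turns_insert: "turns (Suc N) (insert N W) = turns N W"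
    "turns (Suc (Suc N)) (insert N W) = insert N (turns N W)"
    "turns (Suc (Suc N)) W = turns (Suc N) W" if "W \<subseteq> {..<N}" for W
    using that by (auto simp: turns_def)
  have fin: "finite (turns N W)" and notin: "N \<notin> turns N W" for W
    by (auto simp: turns_def intro: finite_subset[of _ "{..<N}"])
  have "card {W \<in> Pow {..<Suc N}. card (turns (Suc N) W) = k} =
      card {W \<in> Pow {..<N}. card (turns (Suc N) W) = k} +
      card {W \<in> Pow {..<N}. card (turns N W) = k}"
    unfolding card_Pow_lessThan_Suc
    by (intro arg_cong2[where f = "(+)"] arg_cong[where f = card])
       (auto simp: turns_insert)
  then have 1: "card {W \<in> Pow {..<Suc N}. card (turns (Suc N) W) = k} =
      Suc (Suc N) choose (2 * k + 1)"
    using Suc.IH[of k] by simp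
  have "card {W \<in> Pow {..<Suc N}. card (turns (Suc (Suc N)) W) = k} =
      card {W \<in> Pow {..<N}. card (turns (Suc N) W) = k} +
      card {W \<in> Pow {..<N}. Suc (card (turns N W)) = k}"
    unfolding card_Pow_lessThan_Suc
    by (intro arg_cong2[where f = "(+)"] arg_cong[where f = card])
       (auto simp: turns_insert fin notin)
  then have 2: "card {W \<in> Pow {..<Suc N}. card (turns (Suc (Suc N)) W) = k} =
      Suc (Suc N) choose (2 * k)"
    \<comment> \<open>For \<open>k = 0\<close> the second set is empty; otherwise it is the first
      count at \<open>k - 1\<close>, and Pascal's rule applies.\<close>
    using Suc.IH[of k] Suc.IH[of "k - 1"] by (cases k) auto
  from 1 2 show ?case by blast
qed

text \<open>Complementation is an involution on the subsets of \<open>{..<N}\<close>.\<close>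

lemma card_turns_compl_eq:
  "card {W \<in> Pow {..<N}. card (turns N ({..<N} - W)) = k} = Suc N choose (2 * k + 1)"
proof -
  have "bij_betw (\<lambda>W. {..<N} - W) {W \<in> Pow {..<N}. card (turns N ({..<N} - W)) = k}
      {W \<in> Pow {..<N}. card (turns N W) = k}"
    by (rule bij_betw_byWitness[where f' = "\<lambda>W. {..<N} - W"]) (auto simp: double_diff)
  from bij_betw_same_card[OF this] show ?thesis using card_turns_eq by simp
qed

lemma card_permutations_by_turns:
  assumes bij: "bij_betw ascents {p \<in> permutations_of_set {1..n}. C p} (Pow {..<n - 1})"
    and "n \<ge> 1"
  shows "card {p \<in> permutations_of_set {1..n}. C p \<and> pk p = k} = n choose (2 * k + 1)"
    and "card {p \<in> permutations_of_set {1..n}. C p \<and> vl p = k} = n choose (2 * k + 1)"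
proof -
  \<comment> \<open>A statistic that depends only on the ascent set can be counted on
    subsets.\<close>
  have transfer: "card {p \<in> permutations_of_set {1..n}. C p \<and> f p = k} =
      card {W \<in> Pow {..<n - 1}. g W = k}"
    if "\<And>p. p \<in> permutations_of_set {1..n} \<Longrightarrow> f p = g (ascents p)" for f g :: "_ \<Rightarrow> nat"
  proof (rule bij_betw_same_card)
    show "bij_betw ascents {p \<in> permutations_of_set {1..n}. C p \<and> f p = k}
        {W \<in> Pow {..<n - 1}. g W = k}"
    proof (rule bij_betw_subset[OF bij])
      show "ascents ` {p \<in> permutations_of_set {1..n}. C p \<and> f p = k} =
          {W \<in> Pow {..<n - 1}. g W = k}"
        using that unfolding bij_betw_imp_surj_on[OF bij, symmetric] by auto
    qed auto
  qed
  have perm: "length p = n" "distinct p" if "p \<in> permutations_of_set {1..n}" for p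
    using that by (auto simp: permutations_of_set_def dest: distinct_card)
  have "card {p \<in> permutations_of_set {1..n}. C p \<and> pk p = k} =
      card {W \<in> Pow {..<n - 1}. card (turns (n - 1) W) = k}"
    by (rule transfer) (simp add: perm pk_eq_card_turns)
  then show "card {p \<in> permutations_of_set {1..n}. C p \<and> pk p = k} = n choose (2 * k + 1)"
    using card_turns_eq[of "n - 1" k] \<open>n \<ge> 1\<close> by simp
  have "card {p \<in> permutations_of_set {1..n}. C p \<and> vl p = k} =
      card {W \<in> Pow {..<n - 1}. card (turns (n - 1) ({..<n - 1} - W)) = k}"
    by (rule transfer) (simp add: perm vl_eq_card_turns)
  then show "card {p \<in> permutations_of_set {1..n}. C p \<and> vl p = k} = n choose (2 * k + 1)"
    using card_turns_compl_eq[of "n - 1" k] \<open>n \<ge> 1\<close> by simp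
qed

section \<open>The two classes\<close>

text \<open>An embedding of three positions is a triple \<open>i < j < l\<close>; comparisons of a
  position with itself are trivial, which leaves six.\<close>

lemma contains_pattern_length3:
  "contains_pattern p [a, b, c] \<longleftrightarrow>
     (\<exists>i j l. i < j \<and> j < l \<and> l < length p \<and>
        (p ! i < p ! j \<longleftrightarrow> a < b) \<and> (p ! j < p ! i \<longleftrightarrow> b < a) \<and>
        (p ! i < p ! l \<longleftrightarrow> a < c) \<and> (p ! l < p ! i \<longleftrightarrow> c < a) \<and>
        (p ! j < p ! l \<longleftrightarrow> b < c) \<and> (p ! l < p ! j \<longleftrightarrow> c < b))"
  (is "_ \<longleftrightarrow> (\<exists>i j l. ?Q i j l)")
proof
  assume "contains_pattern p [a, b, c]"
  then obtain f :: "nat \<Rightarrow> nat" where f: "strict_mono_on {..<3} f" "f ` {..<3} \<subseteq> {..<length p}"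
    "\<And>x y. x < 3 \<Longrightarrow> y < 3 \<Longrightarrow> p ! f x < p ! f y \<longleftrightarrow> [a, b, c] ! x < [a, b, c] ! y"
    by (auto simp: contains_pattern_def eval_nat_numeral)
  have "f 0 < f 1" "f 1 < f 2" "f 2 < length p"
    using f(1,2) by (auto simp: strict_mono_on_def image_subset_iff)
  then have "?Q (f 0) (f 1) (f 2)"
    using f(3)[of 0 1] f(3)[of 1 0] f(3)[of 0 2] f(3)[of 2 0] f(3)[of 1 2] f(3)[of 2 1] by simp
  then show "\<exists>i j l. ?Q i j l" by blast
next
  assume "\<exists>i j l. ?Q i j l"
  then obtain i j l where Q: "?Q i j l" by blast
  have all3: "(\<forall>x < length [a, b, c]. P x) \<longleftrightarrow> P 0 \<and> P 1 \<and> P 2" for P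
    by (auto simp: less_Suc_eq numeral_2_eq_2)
  have 3: "{..<length [a, b, c]} = {0, 1, 2}" by auto
  show "contains_pattern p [a, b, c]"
    unfolding contains_pattern_def all3 3
    by (rule exI[where x = "\<lambda>x. [i, j, l] ! x"]) (use Q in \<open>auto simp: strict_mono_on_def\<close>)
qed

lemma avoids_length3D:
  assumes "avoids p [a, b, c]" and "i < j" "j < l" "l < length p"
  shows "\<not> ((p ! i < p ! j \<longleftrightarrow> a < b) \<and> (p ! j < p ! i \<longleftrightarrow> b < a) \<and>
        (p ! i < p ! l \<longleftrightarrow> a < c) \<and> (p ! l < p ! i \<longleftrightarrow> c < a) \<and>
        (p ! j < p ! l \<longleftrightarrow> b < c) \<and> (p ! l < p ! j \<longleftrightarrow> c < b))"
  using assms unfolding avoids_def contains_pattern_length3 by blast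

text \<open>Avoidance says that no entry lies strictly between two later ones, so each later entry
  compares with \<open>p ! i\<close> as the next one does.\<close>

lemma avoids_213_231_iff:
  assumes d: "distinct p"
  shows "avoids p [2, 1, 3] \<and> avoids p [2, 3, 1] \<longleftrightarrow>
    (\<forall>j < length p. \<forall>i < j. p ! i < p ! j \<longleftrightarrow> i \<in> ascents p)"
    (is "?A \<longleftrightarrow> ?B")
proof
  assume ?A
  then have A: "\<not> (p ! j < p ! i \<and> p ! i < p ! l)" "\<not> (p ! l < p ! i \<and> p ! i < p ! j)"
    if "i < j" "j < l" "l < length p" for i j l
    using \<open>?A\<close> avoids_length3D[of p 2 1 3 i j l] avoids_length3D[of p 2 3 1 i j l] that
    by (auto simp del: One_nat_def)
  show ?B
  proof (intro allI impI)
    fix i j assume ij: "j < length p" "i < j"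
    have ne: "p ! i \<noteq> p ! j" "p ! i \<noteq> p ! Suc i"
      using d ij by (simp_all add: nth_eq_iff_index_eq)
    show "p ! i < p ! j \<longleftrightarrow> i \<in> ascents p"
    proof (cases "j = Suc i")
      case False
      then show ?thesis using A[of i "Suc i" j] ij ne by (auto simp: ascents_def)
    qed (use ij in \<open>simp add: ascents_def\<close>)
  qed
next
  assume ?B
  then have B: "p ! i < p ! j \<longleftrightarrow> p ! i < p ! l" if "i < j" "j < l" "l < length p" for i j l
    using that by (meson less_trans)
  show ?A
    unfolding avoids_def contains_pattern_length3 by (auto dest: B)
qed

text \<open>If \<open>p ! i < p ! l\<close>, an entry between them in position must also lie between
  them in value: a larger one gives 132, a smaller one 213. Induction on the right end reduces this
  to adjacent ascents.\<close>

lemma avoids_132_213_iff: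
  assumes d: "distinct p"
  shows "avoids p [1, 3, 2] \<and> avoids p [2, 1, 3] \<longleftrightarrow>
    (\<forall>j < length p. \<forall>i < j. p ! i < p ! j \<longleftrightarrow> {i..<j} \<subseteq> ascents p)"
    (is "?A \<longleftrightarrow> ?B")
proof
  assume ?A
  then have A: "\<not> (p ! i < p ! l \<and> p ! l < p ! j)" "\<not> (p ! j < p ! i \<and> p ! i < p ! l)"
    if "i < j" "j < l" "l < length p" for i j l
    using \<open>?A\<close> avoids_length3D[of p 1 3 2 i j l] avoids_length3D[of p 2 1 3 i j l] that
    by (auto simp del: One_nat_def)
  have "i < j \<longrightarrow> j < length p \<longrightarrow> (p ! i < p ! j \<longleftrightarrow> {i..<j} \<subseteq> ascents p)" for i j
  proof (induction j)
    case (Suc j)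
    show ?case
    proof (intro impI)
      assume ij: "i < Suc j" "Suc j < length p"
      show "p ! i < p ! Suc j \<longleftrightarrow> {i..<Suc j} \<subseteq> ascents p"
      proof (cases "i = j")
        case False
        then have i: "i < j" using ij by simp
        have ne: "p ! i \<noteq> p ! j" "p ! i \<noteq> p ! Suc j" "p ! j \<noteq> p ! Suc j"
          using d i ij by (simp_all add: nth_eq_iff_index_eq)
        have "p ! i < p ! Suc j \<longleftrightarrow> p ! i < p ! j \<and> p ! j < p ! Suc j"
          using A[of i j "Suc j"] i ij ne by (auto simp: not_less)
        then show ?thesis
          using Suc.IH i ij by (simp add: atLeastLessThanSuc ascents_def conj_commute)
      qed (use ij in \<open>simp add: ascents_def\<close>)
    qed
  qed simp
  then show ?B by blast
next
  assume ?B
  then have B: "p ! i < p ! l \<longleftrightarrow> p ! i < p ! j \<and> p ! j < p ! l"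
    if "i < j" "j < l" "l < length p" for i j l
  proof -
    have "{i..<l} = {i..<j} \<union> {j..<l}" using that by auto
    then show ?thesis using \<open>?B\<close> that by simp
  qed
  show ?A
    unfolding avoids_def contains_pattern_length3 by (auto dest: B)
qed

lemma bij_betw_ascents_213_231:
  "bij_betw ascents
     {p \<in> permutations_of_set {1..n}. avoids p [2, 1, 3] \<and> avoids p [2, 3, 1]} (Pow {..<n - 1})"
\<comment> \<open>Positions in \<open>W\<close> lie below all later ones, the others above; the
  leftmost of three positions decides its two comparisons.\<close>
proof (rule bij_betw_ascents[where R = "\<lambda>W i j. i < j \<and> i \<in> W \<or> j < i \<and> j \<notin> W"], goal_cases)
  case (2 W i j l)
  then show ?case by (metis less_trans linorder_neqE_nat)
next
  case (5 p)
  then show ?case by (auto simp: avoids_213_231_iff simp del: One_nat_def)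
qed auto

lemma bij_betw_ascents_132_213:
  "bij_betw ascents
     {p \<in> permutations_of_set {1..n}. avoids p [1, 3, 2] \<and> avoids p [2, 1, 3]} (Pow {..<n - 1})"
\<comment> \<open>\<open>W\<close> links adjacent positions into blocks: \<open>R\<close> increases
  inside a block and puts later blocks below earlier ones.\<close>
proof (rule bij_betw_ascents[where
      R = "\<lambda>W i j. i < j \<and> {i..<j} \<subseteq> W \<or> j < i \<and> \<not> {j..<i} \<subseteq> W"], goal_cases)
  case (2 W i j l)
  have split: "{x..<z} \<subseteq> W \<longleftrightarrow> {x..<y} \<subseteq> W \<and> {y..<z} \<subseteq> W" if "x < y" "y < z" for x y z
  proof -
    have "{x..<z} = {x..<y} \<union> {y..<z}" using that by auto
    then show ?thesis by simp
  qed
  from 2 show ?case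
    using split[of i j l] split[of i l j] split[of j i l] split[of j l i] split[of l i j] split[of l j i]
    by (cases i j rule: linorder_cases; cases j l rule: linorder_cases;
        cases i l rule: linorder_cases) simp_all
next
  case (5 p)
  then show ?case by (auto simp: avoids_132_213_iff simp del: One_nat_def)
qed auto

theorem proposition12:
  fixes n k :: nat
  assumes "n \<ge> 1"
  shows "a_pk n k [1, 3, 2] [2, 1, 3] = a_vl n k [1, 3, 2] [2, 1, 3]
    \<and> a_vl n k [1, 3, 2] [2, 1, 3] = a_pk n k [2, 1, 3] [2, 3, 1]
    \<and> a_pk n k [2, 1, 3] [2, 3, 1] = a_vl n k [2, 1, 3] [2, 3, 1]
    \<and> a_vl n k [2, 1, 3] [2, 3, 1] = n choose (2 * k + 1)"
  using card_permutations_by_turns[OF bij_betw_ascents_132_213 assms, of k]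
    card_permutations_by_turns[OF bij_betw_ascents_213_231 assms, of k]
  by (simp add: a_pk_def a_vl_def conj_assoc)

end
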